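(* Let $(V,d)$ be a finite metric space, $w$ a nonnegative weight function on $V$, $L$ a budget with $L<w(V)$, and $p\le|V|$ an integer. For $\mathcal{S}\subseteq V$ let $\mathrm{cost}_p(\mathcal{S})=\min_{V'\subseteq V,|V'|\ge p}\max_{v\in V'}\min_{u\in\mathcal{S}}d(v,u)$, and let $\mathrm{OPT}=\min\{\mathrm{cost}_p(\mathcal{S}):\mathcal{S}\subseteq V,\ w(\mathcal{S})\le L\}$. For $v\in V$ let $\mathsf{B}(v)=\{u:d(u,v)\le\mathrm{OPT}\}$ and $\mathsf{E}(v)=\{u:d(u,v)\le 3\,\mathrm{OPT}\}$. Run the following procedure: set $\mathcal{S}=\emptyset$, $\mathcal{C}=\emptyset$; while $w(\mathcal{S})<L$ and $V\setminus\mathcal{C}\ne\emptyset$, choose $i\in V\setminus\mathcal{S}$ maximizing $|\mathsf{B}(i)\setminus\mathcal{C}|/w(i)$ (with the conventions $A/0=\infty$ for $A>0$ and $0/0=0$), and set $\mathcal{S}\leftarrow\mathcal{S}\cup\{i\}$, $\mathcal{C}\leftarrow\mathcal{C}\cup\mathsf{E}(i)$; return $\mathcal{S}$. Then the returned set satisfies $w(\mathcal{S})<L+\max_{v\in V}w(v)$ and $\mathrm{cost}_p(\mathcal{S})\le 3\,\mathrm{OPT}$.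
   Formalization: The budget is taken to satisfy L ≥ 0 (otherwise OPT is a minimum over no sets), and if L = 0 and p > 0 all weights are assumed positive: with a zero-weight vertex the procedure would return the empty set, of infinite cost, although OPT is finite. *)

theory Defs
  imports "HOL-Analysis.Analysis"
begin

text \<open>
  Costs live in \<^typ>\<open>ennreal\<close>, where every min or max over a finite nonempty family is the
  corresponding INF or SUP. For empty families this gives the usual conventions: the distance to
  an empty set of centers is \<open>\<infinity>\<close>, the maximum of no distances is 0, and the optimum is
  \<open>\<infinity>\<close> if no solution of finite cost is affordable.
\<close>

definition cost :: "'a set \<Rightarrow> ('a \<Rightarrow> 'a \<Rightarrow> real) \<Rightarrow> int \<Rightarrow> 'a set \<Rightarrow> ennreal" where
  "cost V d p S =
     (INF V'\<in>{V'. V' \<subseteq> V \<and> p \<le> int (card V')}. SUP v\<in>V'. INF u\<in>S. ennreal (d v u))"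

definition opt :: "'a set \<Rightarrow> ('a \<Rightarrow> 'a \<Rightarrow> real) \<Rightarrow> ('a \<Rightarrow> real) \<Rightarrow> real \<Rightarrow> int \<Rightarrow> ennreal" where
  "opt V d w L p = (INF S\<in>{S. S \<subseteq> V \<and> sum w S \<le> L}. cost V d p S)"

definition ball_B :: "'a set \<Rightarrow> ('a \<Rightarrow> 'a \<Rightarrow> real) \<Rightarrow> ('a \<Rightarrow> real) \<Rightarrow> real \<Rightarrow> int \<Rightarrow> 'a \<Rightarrow> 'a set" where
  "ball_B V d w L p v = {u \<in> V. ennreal (d u v) \<le> opt V d w L p}"

definition ball_E :: "'a set \<Rightarrow> ('a \<Rightarrow> 'a \<Rightarrow> real) \<Rightarrow> ('a \<Rightarrow> real) \<Rightarrow> real \<Rightarrow> int \<Rightarrow> 'a \<Rightarrow> 'a set" where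
  "ball_E V d w L p v = {u \<in> V. ennreal (d u v) \<le> 3 * opt V d w L p}"

text \<open>
  Division in \<^typ>\<open>ennreal\<close> satisfies \<open>a / 0 = \<infinity>\<close> for \<open>a > 0\<close> and \<open>0 / 0 = 0\<close>.
\<close>

definition gain_ratio ::
  "'a set \<Rightarrow> ('a \<Rightarrow> 'a \<Rightarrow> real) \<Rightarrow> ('a \<Rightarrow> real) \<Rightarrow> real \<Rightarrow> int \<Rightarrow> 'a set \<Rightarrow> 'a \<Rightarrow> ennreal" where
  "gain_ratio V d w L p C i = of_nat (card (ball_B V d w L p i - C)) / ennreal (w i)"

lemma gain_ratio_zero_weight:
  assumes "w i = 0"
  shows "gain_ratio V d w L p C i = (if card (ball_B V d w L p i - C) = 0 then 0 else \<infinity>)"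
  using assms by (simp add: gain_ratio_def ennreal_divide_zero)

text \<open>
  The states \<open>(S, C)\<close> the loop can pass through, ties in the choice of \<open>i\<close> being broken arbitrarily.
\<close>

inductive greedy_state ::
  "'a set \<Rightarrow> ('a \<Rightarrow> 'a \<Rightarrow> real) \<Rightarrow> ('a \<Rightarrow> real) \<Rightarrow> real \<Rightarrow> int \<Rightarrow> 'a set \<Rightarrow> 'a set \<Rightarrow> bool"
  for V d w L p where
  init: "greedy_state V d w L p {} {}"
| step: "greedy_state V d w L p (S \<union> {i}) (C \<union> ball_E V d w L p i)"
    if "greedy_state V d w L p S C"
      and "sum w S < L" and "V - C \<noteq> {}"
      and "is_arg_max (gain_ratio V d w L p C) (\<lambda>j. j \<in> V - S) i"

definition greedy_returns ::
  "'a set \<Rightarrow> ('a \<Rightarrow> 'a \<Rightarrow> real) \<Rightarrow> ('a \<Rightarrow> real) \<Rightarrow> real \<Rightarrow> int \<Rightarrow> 'a set \<Rightarrow> bool" where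
  "greedy_returns V d w L p S \<longleftrightarrow>
     (\<exists>C. greedy_state V d w L p S C \<and> \<not> (sum w S < L \<and> V - C \<noteq> {}))"

text \<open>
  Each iteration adds to \<open>S\<close> a new element of \<open>V\<close>, so a run has at most \<open>card V\<close> iterations.
  It never gets stuck, hence every run can be continued until it returns.
\<close>

lemma greedy_state_subset: "greedy_state V d w L p S C \<Longrightarrow> S \<subseteq> V"
  by (induction rule: greedy_state.induct) (auto simp: is_arg_max_def)

lemma greedy_choice_exists:
  assumes "finite V" and "L < sum w V" and "greedy_state V d w L p S C" and "sum w S < L"
  shows "\<exists>i. is_arg_max (gain_ratio V d w L p C) (\<lambda>j. j \<in> V - S) i"
proof -
  have "V - S \<noteq> {}"
  proof
    assume "V - S = {}"
    with greedy_state_subset[OF assms(3)] have "S = V" by blast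
    with assms(2,4) show False by simp
  qed
  moreover have fin: "finite (V - S)"
    using assms(1) by simp
  ultimately have "Max (gain_ratio V d w L p C ` (V - S)) \<in> gain_ratio V d w L p C ` (V - S)"
    by (intro Max_in) auto
  then obtain i where i: "i \<in> V - S"
    "gain_ratio V d w L p C i = Max (gain_ratio V d w L p C ` (V - S))"
    by auto
  have "gain_ratio V d w L p C j \<le> gain_ratio V d w L p C i" if "j \<in> V - S" for j
    unfolding i(2) using fin that by (intro Max_ge) auto
  with i(1) show ?thesis
    by (auto simp: is_arg_max_linorder)
qed

lemma greedy_run_completes:
  assumes "finite V" and "L < sum w V" and "greedy_state V d w L p S C"
  shows "\<exists>S'. S \<subseteq> S' \<and> greedy_returns V d w L p S'"
  using assms(3)
proof (induction "card (V - S)" arbitrary: S C rule: less_induct)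
  case less
  show ?case
  proof (cases "sum w S < L \<and> V - C \<noteq> {}")
    case False
    with less.prems have "greedy_returns V d w L p S"
      unfolding greedy_returns_def by (intro exI[of _ C] conjI)
    then show ?thesis
      by (intro exI[of _ S] conjI) auto
  next
    case True
    with greedy_choice_exists[OF assms(1,2) less.prems] obtain i
      where i: "is_arg_max (gain_ratio V d w L p C) (\<lambda>j. j \<in> V - S) i"
      by blast
    have "card (V - (S \<union> {i})) < card (V - S)"
      using i assms(1) by (intro psubset_card_mono) (auto simp: is_arg_max_def)
    moreover have "greedy_state V d w L p (S \<union> {i}) (C \<union> ball_E V d w L p i)"
      using True i by (intro greedy_state.step[OF less.prems]) simp_all
    ultimately obtain S' where "S \<union> {i} \<subseteq> S'" "greedy_returns V d w L p S'"
      by (metis less.hyps)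
    then show ?thesis
      by (intro exI[of _ S'] conjI) auto
  qed
qed

text \<open>
  For \<open>L = 0\<close> the loop body is never executed. If moreover \<open>p > 0\<close> and some vertex has weight 0,
  the optimum is finite although the returned set is empty.
\<close>

lemma zero_budget_failure:
  assumes "finite V" and "0 < p" and "p \<le> int (card V)" and "z \<in> V" and "w z = 0"
  shows "greedy_returns V d w 0 p {}" and "\<not> cost V d p {} \<le> 3 * opt V d w 0 p"
proof -
  show "greedy_returns V d w 0 p {}"
    by (auto simp: greedy_returns_def intro: greedy_state.init)
  have "(SUP v\<in>V'. INF u\<in>{}. ennreal (d v u)) = \<infinity>" if "p \<le> int (card V')" for V'
    using that assms(2) by (cases "V' = {}") auto
  hence inf: "cost V d p {} = \<infinity>"
    unfolding cost_def by (auto intro!: INF_eqI simp: top_unique)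
  have "opt V d w 0 p \<le> cost V d p {z}"
    unfolding opt_def using assms by (intro INF_lower) auto
  also have "\<dots> \<le> (SUP v\<in>V. INF u\<in>{z}. ennreal (d v u))"
    unfolding cost_def using assms by (intro INF_lower) auto
  also have "\<dots> \<le> ennreal (\<Sum>v\<in>V. \<bar>d v z\<bar>)"
  proof (rule SUP_least)
    fix v assume "v \<in> V"
    hence "\<bar>d v z\<bar> \<le> (\<Sum>v\<in>V. \<bar>d v z\<bar>)"
      using assms(1) by (intro member_le_sum) auto
    thus "(INF u\<in>{z}. ennreal (d v u)) \<le> ennreal (\<Sum>v\<in>V. \<bar>d v z\<bar>)"
      by (auto intro!: ennreal_leI)
  qed
  also have "\<dots> < \<infinity>"
    by simp
  finally show "\<not> cost V d p {} \<le> 3 * opt V d w 0 p"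
    by (simp add: inf top_unique ennreal_mult_eq_top_iff)
qed

end

theory Submission
  imports Defs
begin

text \<open>
  Fix an optimal solution \<open>X\<close> and let \<open>B(X)\<close> be the union of the balls \<open>B(x)\<close> around its centers;
  it has at least \<open>p\<close> points. Call \<open>x \<in> X\<close> hit by \<open>S\<close> if \<open>B(x)\<close> meets \<open>B(i)\<close> for some \<open>i \<in> S\<close>;
  by the triangle inequality, \<open>B(x) \<subseteq> E(i)\<close> is then covered. Suppose the greedy choice \<open>i\<close> has
  ratio \<open>\<rho>\<^sub>i\<close>. Every new point of \<open>B(i)\<close> that lies in \<open>B(X)\<close> belongs to the ball of some newly hit
  \<open>x\<close>, and this ball has at most \<open>\<rho>\<^sub>i w(x)\<close> uncovered points because \<open>i\<close> was preferred to \<open>x\<close>. So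
  at least \<open>\<rho>\<^sub>i (w(i) - w(newly hit))\<close> points outside \<open>B(X)\<close> become covered. The ratios decrease
  during the run, so with \<open>\<rho>\<close> the last ratio at least \<open>\<rho> (w(S) - w(hit))\<close> points outside
  \<open>B(X)\<close> are covered in total, whereas at most \<open>\<rho> (w(X) - w(hit))\<close> points of \<open>B(X)\<close> remain
  uncovered. If the loop stops because \<open>w(S) \<ge> L \<ge> w(X)\<close>, then \<open>C\<close> has at least as many
  points as \<open>B(X)\<close>.
\<close>

section \<open>Quotients with zero denominators and attained infima\<close>

text \<open>Cross-multiplying survives zero denominators: for \<open>y = 0\<close> the left side
  vanishes, and for \<open>x = 0 < y\<close> the finite right quotient rules out
  \<open>a / 0 = \<infinity>\<close>, so \<open>a = 0\<close>.\<close>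

lemma ennreal_divide_le_divideD:
  assumes "of_nat a / ennreal x \<le> of_nat b / ennreal y" "0 \<le> x" "0 \<le> y"
  shows "real a * y \<le> x * real b"
proof (cases "y = 0")
  case True
  then show ?thesis using assms by simp
next
  case False
  then have y: "y > 0" using assms by simp
  have fin: "of_nat b / ennreal y = ennreal (real b / y)"
    using y by (simp add: divide_ennreal ennreal_of_nat_eq_real_of_nat)
  show ?thesis
  proof (cases "x = 0")
    case True
    then have "a = 0"
      using assms(1) unfolding fin by (cases "a = 0") (auto simp: ennreal_divide_zero top_unique)
    then show ?thesis using assms by simp
  next
    case False
    then have x: "x > 0" using assms by simp
    then have "of_nat a / ennreal x = ennreal (real a / x)"
      by (simp add: divide_ennreal ennreal_of_nat_eq_real_of_nat)
    then have "real a / x \<le> real b / y"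
      using assms(1) y unfolding fin by (simp add: ennreal_le_iff)
    then show ?thesis using x y by (simp add: field_simps)
  qed
qed

lemma finite_INF_attained:
  fixes f :: "'b \<Rightarrow> 'c :: complete_linorder"
  assumes "finite A" "A \<noteq> {}"
  shows "\<exists>a\<in>A. (INF x\<in>A. f x) = f a"
proof -
  have "(INF x\<in>A. f x) = Min (f ` A)" using assms by (simp add: Min_Inf)
  also have "\<dots> \<in> f ` A" using assms by (intro Min_in) auto
  finally show ?thesis by blast
qed

section \<open>Balls, hit centers and the greedy choice\<close>

locale weighted_partial_center = Metric_space V d
  for V :: "'a set" and d :: "'a \<Rightarrow> 'a \<Rightarrow> real" +
  fixes w :: "'a \<Rightarrow> real" and L :: real and p :: int
  assumes finite_V: "finite V"
    and w_nonneg: "v \<in> V \<Longrightarrow> 0 \<le> w v"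
begin

abbreviation "B \<equiv> ball_B V d w L p"
abbreviation "E \<equiv> ball_E V d w L p"

definition hit :: "'a set \<Rightarrow> 'a set \<Rightarrow> 'a set" where
  "hit X S = {x \<in> X. \<exists>i\<in>S. B x \<inter> B i \<noteq> {}}"

lemma B_subset: "B v \<subseteq> V" and E_subset: "E v \<subseteq> V"
  by (auto simp: ball_B_def ball_E_def)

lemma finite_B: "finite (B v)"
  using B_subset finite_V by (rule finite_subset)

lemma center_in_B: "v \<in> V \<Longrightarrow> v \<in> B v"
  by (simp add: ball_B_def)

text \<open>With \<open>y\<close> a common point of the two balls, the path from \<open>u\<close>
  via \<open>x\<close> and \<open>y\<close> to \<open>i\<close> has three legs, each at most
  OPT.\<close>

lemma B_subset_E_if_meets:
  assumes "x \<in> V" "i \<in> V" "B x \<inter> B i \<noteq> {}"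
  shows "B x \<subseteq> E i"
proof
  fix u assume u: "u \<in> B x"
  obtain y where y: "y \<in> B x" "y \<in> B i" using assms by blast
  let ?r = "opt V d w L p"
  have V: "u \<in> V" "y \<in> V" using u y B_subset by blast+
  have "d u i \<le> d u x + d y x + d y i"
    using triangle[of u x i] triangle[of x y i] V assms by (simp add: commute)
  then have "ennreal (d u i) \<le> ennreal (d u x) + ennreal (d y x) + ennreal (d y i)"
    by (simp add: ennreal_leI flip: ennreal_plus)
  also have "\<dots> \<le> ?r + ?r + ?r"
    using u y by (intro add_mono) (auto simp: ball_B_def)
  also have "\<dots> = 3 * ?r"
    by (simp only: numeral_Bit1 numeral_One distrib_right mult_1 mult_2)
  finally show "u \<in> E i" using V by (simp add: ball_E_def)
qed

lemma B_subset_E: "v \<in> V \<Longrightarrow> B v \<subseteq> E v"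
  using B_subset_E_if_meets center_in_B by blast

lemma greedy_covered: "greedy_state V d w L p S C \<Longrightarrow> C = (\<Union>i\<in>S. E i)"
  by (induction rule: greedy_state.induct) auto

lemma hit_covered:
  assumes "greedy_state V d w L p S C" "X \<subseteq> V" "x \<in> hit X S"
  shows "B x \<subseteq> C"
  using assms greedy_covered[OF assms(1)] greedy_state_subset[OF assms(1)] B_subset_E_if_meets
  unfolding hit_def by blast

text \<open>The maximality of \<open>i\<close> only concerns \<open>V - S\<close>, but the ball of a
  center already in \<open>S\<close> has no uncovered points, so \<open>x\<close> may be any
  vertex.\<close>

lemma greedy_choice_ratio:
  assumes st: "greedy_state V d w L p S C"
    and i: "is_arg_max (gain_ratio V d w L p C) (\<lambda>j. j \<in> V - S) i"
    and x: "x \<in> V"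
  shows "real (card (B x - C)) * w i \<le> w x * real (card (B i - C))"
proof (cases "x \<in> S")
  case True
  then have empty: "B x - C = {}" using greedy_covered[OF st] B_subset_E[OF x] by blast
  show ?thesis unfolding empty using w_nonneg[OF x] by simp
next
  case False
  then have "gain_ratio V d w L p C x \<le> gain_ratio V d w L p C i"
    using i x by (simp add: is_arg_max_linorder)
  moreover have "i \<in> V" using i by (simp add: is_arg_max_def)
  ultimately show ?thesis
    unfolding gain_ratio_def using ennreal_divide_le_divideD w_nonneg x by blast
qed

section \<open>Counting covered points outside the optimal balls\<close>

text \<open>Here \<open>\<rho>\<close> is any lower bound for the ratio of \<open>i\<close>, so that
  a single value can serve all iterations.\<close>

lemma covered_outside_step:
  fixes \<rho> :: real
  assumes st: "greedy_state V d w L p S C"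
    and i: "is_arg_max (gain_ratio V d w L p C) (\<lambda>j. j \<in> V - S) i"
    and X: "X \<subseteq> V" and \<rho>: "0 \<le> \<rho>" "\<rho> * w i \<le> card (B i - C)"
    and IH: "\<rho> * (sum w S - sum w (hit X S)) \<le> card (C - \<Union>(B ` X))"
  shows "\<rho> * (sum w (S \<union> {i}) - sum w (hit X (S \<union> {i}))) \<le> card (C \<union> E i - \<Union>(B ` X))"
proof -
  define G where "G = B i - C"
  define N where "N = hit X (S \<union> {i}) - hit X S"
  have iV: "i \<in> V" "i \<notin> S" using i by (auto simp: is_arg_max_def)
  have SV: "S \<subseteq> V" using greedy_state_subset[OF st] .
  have CV: "C \<subseteq> V" using greedy_covered[OF st] E_subset by blast
  note fin = finite_subset[OF SV finite_V] finite_subset[OF CV finite_V] finite_subset[OF X finite_V]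
  have NX: "N \<subseteq> X" unfolding N_def hit_def by blast
  have finN: "finite N" using NX fin(3) by (rule finite_subset)
  have finG: "finite G" unfolding G_def using finite_B by simp
  have sumS: "sum w (S \<union> {i}) = sum w S + w i" using iV fin by simp
  have "hit X (S \<union> {i}) = hit X S \<union> N" unfolding N_def hit_def by blast
  moreover have "finite (hit X S)" unfolding hit_def using fin by simp
  moreover have "hit X S \<inter> N = {}" unfolding N_def by blast
  ultimately have sumH: "sum w (hit X (S \<union> {i})) = sum w (hit X S) + sum w N"
    using finN by (simp only: sum.union_disjoint)
  have wN: "0 \<le> sum w N" using NX X w_nonneg by (intro sum_nonneg) blast
  have "\<rho> * (w i - sum w N) \<le> card (G - \<Union>(B ` X))"
  \<comment> \<open>If the newly hit centers outweigh \<open>i\<close>, there is nothing to show;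
    otherwise \<open>w i\<close> is positive and its ratio is a real number.\<close>
  proof (cases "w i \<le> sum w N")
    case True
    then have "\<rho> * (w i - sum w N) \<le> 0" using \<rho>(1) by (simp add: mult_nonneg_nonpos)
    then show ?thesis by linarith
  next
    case False
    then have wi: "w i > 0" using wN by linarith
    define q where "q = card G / w i"
    have q: "\<rho> \<le> q" unfolding q_def G_def using \<rho>(2) wi by (simp add: field_simps)
    have "G \<inter> \<Union>(B ` X) \<subseteq> (\<Union>x\<in>N. B x - C)"
    proof
      fix y assume "y \<in> G \<inter> \<Union>(B ` X)"
      then obtain x where x: "x \<in> X" "y \<in> B x" "y \<in> B i" "y \<notin> C" unfolding G_def by blast
      then have "x \<notin> hit X S" using hit_covered[OF st X] by blast
      then show "y \<in> (\<Union>x\<in>N. B x - C)" using x unfolding N_def hit_def by blast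
    qed
    then have "card (G \<inter> \<Union>(B ` X)) \<le> card (\<Union>x\<in>N. B x - C)"
      using finN finite_B by (intro card_mono) auto
    also have "\<dots> \<le> (\<Sum>x\<in>N. card (B x - C))" using finN by (rule card_UN_le)
    finally have "real (card (G \<inter> \<Union>(B ` X))) \<le> (\<Sum>x\<in>N. real (card (B x - C)))"
      by (simp flip: of_nat_sum)
    also have "\<dots> \<le> (\<Sum>x\<in>N. w x * q)"
    proof (rule sum_mono)
      fix x assume "x \<in> N"
      then have "x \<in> V" using NX X by blast
      from greedy_choice_ratio[OF st i this] show "real (card (B x - C)) \<le> w x * q"
        unfolding q_def G_def using wi by (simp add: field_simps)
    qed
    also have "\<dots> = q * sum w N" by (simp add: sum_distrib_left mult.commute)
    finally have "real (card (G \<inter> \<Union>(B ` X))) \<le> q * sum w N" .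
    moreover have "real (card G) = q * w i" unfolding q_def using wi by simp
    moreover have "card G = card (G \<inter> \<Union>(B ` X)) + card (G - \<Union>(B ` X))"
      using finG by (subst card_Un_disjoint[symmetric]) (auto intro: arg_cong[of _ _ card])
    ultimately have "q * (w i - sum w N) \<le> card (G - \<Union>(B ` X))"
      by (simp add: algebra_simps)
    moreover have "\<rho> * (w i - sum w N) \<le> q * (w i - sum w N)"
      using q False by (intro mult_right_mono) auto
    ultimately show ?thesis by linarith
  qed
  moreover have "card (C - \<Union>(B ` X)) + card (G - \<Union>(B ` X)) \<le> card (C \<union> E i - \<Union>(B ` X))"
  proof -
    have "card (C - \<Union>(B ` X)) + card (G - \<Union>(B ` X))
        = card ((C - \<Union>(B ` X)) \<union> (G - \<Union>(B ` X)))"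
      using fin finG by (subst card_Un_disjoint) (auto simp: G_def)
    also have "\<dots> \<le> card (C \<union> E i - \<Union>(B ` X))"
      using fin finite_subset[OF E_subset finite_V] B_subset_E[OF iV(1)]
      by (intro card_mono) (auto simp: G_def)
    finally show ?thesis .
  qed
  ultimately show ?thesis
    using IH unfolding sumS sumH by (simp add: algebra_simps)
qed

text \<open>
  The hypothesis on \<open>v\<close> says that \<open>\<rho>\<close> is at most the ratio of a still available candidate, hence
  at most all ratios chosen so far.
\<close>

lemma covered_outside:
  fixes \<rho> :: real
  assumes "greedy_state V d w L p S C" "X \<subseteq> V" "0 \<le> \<rho>"
    and "v \<in> V - S" "0 < w v" "\<rho> * w v \<le> card (B v - C)"
  shows "\<rho> * (sum w S - sum w (hit X S)) \<le> card (C - \<Union>(B ` X))"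
  using assms(1,4,6)
proof (induction rule: greedy_state.induct)
  case init
  then show ?case by (simp add: hit_def)
next
  case (step S C i)
  \<comment> \<open>Coverage only grows, so the bound on \<open>v\<close> also holds in the earlier
    state, where \<open>i\<close> was preferred to \<open>v\<close>.\<close>
  have "card (B v - (C \<union> E i)) \<le> card (B v - C)"
    using finite_B by (intro card_mono) auto
  with step.prems(2) have v: "\<rho> * w v \<le> card (B v - C)" by linarith
  have iV: "i \<in> V" using step.hyps by (simp add: is_arg_max_def)
  have "\<rho> * w v * w i \<le> card (B v - C) * w i"
    using v w_nonneg[OF iV] by (rule mult_right_mono)
  also have "\<dots> \<le> w v * card (B i - C)"
    using greedy_choice_ratio[OF step.hyps(1) step.hyps(4)] assms(4) by simp
  finally have "w v * (\<rho> * w i) \<le> w v * card (B i - C)" by (simp add: mult_ac)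
  then have "\<rho> * w i \<le> card (B i - C)" using assms(5) by simp
  moreover have "\<rho> * (sum w S - sum w (hit X S)) \<le> card (C - \<Union>(B ` X))"
    using step.IH v step.prems(1) by blast
  ultimately show ?case
    using covered_outside_step[OF step.hyps(1) step.hyps(4) assms(2,3)] by blast
qed

text \<open>For the last iteration, \<open>\<rho>\<close> is the ratio of \<open>i\<close>, and
  \<open>i\<close> itself is the available candidate required by
  \<open>covered_outside\<close>.\<close>

lemma card_covered_ge:
  assumes st: "greedy_state V d w L p S C"
    and i: "is_arg_max (gain_ratio V d w L p C) (\<lambda>j. j \<in> V - S) i"
    and X: "X \<subseteq> V" "sum w X \<le> sum w (S \<union> {i})" and wi: "0 < w i"
  shows "card (\<Union>(B ` X)) \<le> card (C \<union> E i)"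
proof -
  let ?U = "\<Union>(B ` X)" and ?C = "C \<union> E i" and ?H = "hit X (S \<union> {i})"
  define \<rho> where "\<rho> = card (B i - C) / w i"
  have iV: "i \<in> V - S" using i by (simp add: is_arg_max_def)
  have \<rho>: "0 \<le> \<rho>" "\<rho> * w i \<le> card (B i - C)" unfolding \<rho>_def using wi by auto
  have out: "\<rho> * (sum w (S \<union> {i}) - sum w ?H) \<le> card (?C - ?U)"
    using covered_outside_step[OF st i X(1) \<rho>] covered_outside[OF st X(1) \<rho>(1) iV wi \<rho>(2)] by blast
  have finX: "finite X" using X(1) finite_V by (rule finite_subset)
  have finC: "finite ?C"
    using greedy_covered[OF st] E_subset by (intro finite_subset[OF _ finite_V]) blast
  have finU: "finite ?U" using finX finite_B by blast
  have HX: "?H \<subseteq> X" unfolding hit_def by blast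
  \<comment> \<open>Balls of hit centers are fully covered, so uncovered points lie only in balls of
    unhit ones.\<close>
  have "?U - ?C \<subseteq> (\<Union>x\<in>X - ?H. B x - C)"
  proof
    fix y assume "y \<in> ?U - ?C"
    then obtain x where x: "x \<in> X" "y \<in> B x" "y \<notin> C" "y \<notin> E i" by blast
    have "x \<notin> hit X S" using hit_covered[OF st X(1)] x by blast
    moreover have "B x \<inter> B i = {}" using B_subset_E_if_meets[of x i] x X(1) iV by blast
    ultimately have "x \<notin> ?H" unfolding hit_def by blast
    then show "y \<in> (\<Union>x\<in>X - ?H. B x - C)" using x by blast
  qed
  then have "card (?U - ?C) \<le> card (\<Union>x\<in>X - ?H. B x - C)"
    using finX finite_B by (intro card_mono) auto
  also have "\<dots> \<le> (\<Sum>x\<in>X - ?H. card (B x - C))" using finX by (intro card_UN_le) auto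
  finally have "real (card (?U - ?C)) \<le> (\<Sum>x\<in>X - ?H. real (card (B x - C)))"
    by (simp flip: of_nat_sum)
  also have "\<dots> \<le> (\<Sum>x\<in>X - ?H. w x * \<rho>)"
  proof (rule sum_mono)
    fix x assume "x \<in> X - ?H"
    then have "x \<in> V" using X by blast
    from greedy_choice_ratio[OF st i this] show "real (card (B x - C)) \<le> w x * \<rho>"
      unfolding \<rho>_def using wi by (simp add: field_simps)
  qed
  also have "\<dots> = \<rho> * (sum w X - sum w ?H)"
    unfolding sum_distrib_right[symmetric] sum_diff[OF finX HX] by (rule mult.commute)
  also have "\<dots> \<le> \<rho> * (sum w (S \<union> {i}) - sum w ?H)"
    using X(2) \<rho>(1) by (intro mult_left_mono) auto
  also note out
  finally have "card (?U - ?C) \<le> card (?C - ?U)" by simp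
  moreover have "card ?U = card (?U \<inter> ?C) + card (?U - ?C)"
    using finU by (subst card_Un_disjoint[symmetric]) (auto intro: arg_cong[of _ _ card])
  moreover have "card ?C = card (?U \<inter> ?C) + card (?C - ?U)"
    using finC by (subst card_Un_disjoint[symmetric]) (auto intro: arg_cong[of _ _ card])
  ultimately show ?thesis by linarith
qed

section \<open>From coverage to cost, and the weight bound\<close>

text \<open>The covered set is itself an admissible \<open>V'\<close> in the cost.\<close>

lemma cost_le_if_covered:
  assumes "greedy_state V d w L p S C" "p \<le> int (card C)"
  shows "cost V d p S \<le> 3 * opt V d w L p"
proof -
  have C: "C = (\<Union>i\<in>S. E i)" using greedy_covered[OF assms(1)] .
  have "cost V d p S \<le> (SUP v\<in>C. INF u\<in>S. ennreal (d v u))"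
    unfolding cost_def using assms(2) C E_subset by (intro INF_lower) auto
  also have "\<dots> \<le> 3 * opt V d w L p"
    by (rule SUP_least) (auto simp: C ball_E_def intro: INF_lower2)
  finally show ?thesis .
qed

lemma optimal_solution:
  assumes "0 \<le> L" "p \<le> int (card V)" "opt V d w L p \<noteq> \<infinity>"
  obtains X where "X \<subseteq> V" "sum w X \<le> L" "p \<le> int (card (\<Union>(B ` X)))"
proof -
  let ?F = "{X. X \<subseteq> V \<and> sum w X \<le> L}"
  have "?F \<noteq> {}" using assms(1) by (auto intro: exI[of _ "{}"])
  with finite_V have "\<exists>X\<in>?F. opt V d w L p = cost V d p X"
    unfolding opt_def by (intro finite_INF_attained) auto
  then obtain X where X: "X \<subseteq> V" "sum w X \<le> L" "opt V d w L p = cost V d p X"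
    by blast
  let ?G = "{V'. V' \<subseteq> V \<and> p \<le> int (card V')}"
  have "?G \<noteq> {}" using assms(2) by blast
  with finite_V have "\<exists>V'\<in>?G. cost V d p X = (SUP v\<in>V'. INF u\<in>X. ennreal (d v u))"
    unfolding cost_def by (intro finite_INF_attained) auto
  then obtain V' where V': "V' \<subseteq> V" "p \<le> int (card V')"
    "cost V d p X = (SUP v\<in>V'. INF u\<in>X. ennreal (d v u))"
    by blast
  have finX: "finite X" using X(1) finite_V by (rule finite_subset)
  have "V' \<subseteq> \<Union>(B ` X)"
  proof
    fix v assume v: "v \<in> V'"
    have le: "(INF u\<in>X. ennreal (d v u)) \<le> opt V d w L p"
      unfolding X(3) V'(3) using v by (rule SUP_upper)
    \<comment> \<open>Without centers the infimum would be \<open>\<infinity>\<close>, exceeding the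
      finite optimum.\<close>
    have "X \<noteq> {}" using le assms(3) by (auto simp: top_unique)
    then obtain u where "u \<in> X" "(INF u\<in>X. ennreal (d v u)) = ennreal (d v u)"
      using finite_INF_attained[OF finX, of "\<lambda>u. ennreal (d v u)"] by blast
    with le v V'(1) show "v \<in> \<Union>(B ` X)" by (auto simp: ball_B_def)
  qed
  then have "card V' \<le> card (\<Union>(B ` X))" using finX finite_B by (intro card_mono) auto
  with V'(2) X(1,2) show ?thesis by (intro that) auto
qed

lemma greedy_weight:
  assumes "greedy_state V d w L p S C" "0 \<le> L" "L < sum w V"
  shows "sum w S < L + Max (w ` V)"
  using assms(1)
proof cases
  case init
  \<comment> \<open>If no iteration runs and \<open>L = 0\<close>, strictness rests on a vertex of
    positive weight.\<close>
  have "\<exists>v\<in>V. 0 < w v"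
    using assms(2,3) sum_nonpos[of V w] by force
  then have "0 < Max (w ` V)" using finite_V by (subst Max_gr_iff) auto
  then show ?thesis using init assms(2) by simp
next
  case (step S' C' i)
  have i: "i \<in> V" "i \<notin> S'" using step by (auto simp: is_arg_max_def)
  have "finite S'" using greedy_state_subset step(3) finite_V finite_subset by metis
  then have "sum w S = sum w S' + w i" using step i by simp
  moreover have "w i \<le> Max (w ` V)" using i finite_V by simp
  ultimately show ?thesis using step by linarith
qed

lemma greedy_cost:
  assumes "greedy_returns V d w L p S" "0 \<le> L" "p \<le> int (card V)"
    and pos: "L = 0 \<and> 0 < p \<longrightarrow> (\<forall>v\<in>V. 0 < w v)"
  shows "cost V d p S \<le> 3 * opt V d w L p"
proof -
  obtain C where st: "greedy_state V d w L p S C" and stop: "L \<le> sum w S \<or> V \<subseteq> C"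
    using assms(1) unfolding greedy_returns_def by force
  have C: "C = (\<Union>i\<in>S. E i)" using greedy_covered[OF st] .
  consider "opt V d w L p = \<infinity>" | "V \<subseteq> C" | "opt V d w L p \<noteq> \<infinity>" "L \<le> sum w S" "\<not> V \<subseteq> C"
    using stop by blast
  then show ?thesis
  proof cases
    case 1
    then show ?thesis by (simp add: ennreal_mult_top)
  next
    case 2
    then have "C = V" using C E_subset by blast
    then show ?thesis using cost_le_if_covered[OF st] assms(3) by simp
  next
    case 3
    obtain X where X: "X \<subseteq> V" "sum w X \<le> L" "p \<le> int (card (\<Union>(B ` X)))"
      using optimal_solution[OF assms(2,3) 3(1)] by blast
    from st have "p \<le> int (card C)"
    proof cases
      case init
      \<comment> \<open>With no iteration the budget is 0; positive weights then force
        \<open>X\<close> to be empty, which cannot cover \<open>p > 0\<close> points.\<close>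
      show ?thesis
      proof (rule ccontr)
        assume "\<not> ?thesis"
        then have p: "0 < p" by linarith
        have "L = 0" using init 3(2) assms(2) by simp
        then have wpos: "\<forall>v\<in>V. 0 < w v" using pos p by blast
        have "X \<noteq> {}" using X(3) p by auto
        then have "0 < sum w X"
          using X(1) wpos finite_subset[OF X(1) finite_V] by (intro sum_pos) auto
        then show False using X(2) \<open>L = 0\<close> by simp
      qed
    next
      case (step S' C' i)
      have i: "i \<notin> S'" using step by (simp add: is_arg_max_def)
      have "finite S'" using greedy_state_subset step(3) finite_V finite_subset by metis
      then have "sum w S = sum w S' + w i" using step i by simp
      \<comment> \<open>The last iteration raised the weight from below \<open>L\<close> to at least
        \<open>L\<close>.\<close>
      then have "0 < w i" using 3(2) step by linarith
      moreover have "sum w X \<le> sum w (S' \<union> {i})" using X(2) 3(2) step(1) by simp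
      ultimately have "card (\<Union>(B ` X)) \<le> card C"
        using card_covered_ge[OF step(3) step(6) X(1)] step(2) by simp
      then show ?thesis using X(3) by linarith
    qed
    then show ?thesis using cost_le_if_covered[OF st] by blast
  qed
qed

end

theorem theorem7:
  fixes V :: "'a set" and d :: "'a \<Rightarrow> 'a \<Rightarrow> real" and w :: "'a \<Rightarrow> real"
    and L :: real and p :: int and S :: "'a set"
  assumes "Metric_space V d" and "finite V"
    and "\<forall>v\<in>V. 0 \<le> w v"
    and "0 \<le> L" and "L < sum w V"
    and "p \<le> int (card V)"
    and "L = 0 \<and> 0 < p \<longrightarrow> (\<forall>v\<in>V. 0 < w v)"
    and "greedy_returns V d w L p S"
  shows "sum w S < L + Max (w ` V) \<and> cost V d p S \<le> 3 * opt V d w L p"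
proof -
  interpret weighted_partial_center V d w L p
    using assms(1-3) by (simp add: weighted_partial_center_def weighted_partial_center_axioms_def)
  obtain C where "greedy_state V d w L p S C"
    using assms(8) unfolding greedy_returns_def by blast
  then show ?thesis
    using greedy_weight assms(4,5) greedy_cost[OF assms(8,4,6,7)] by blast
qed

end
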